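(* Let $G$ be a finite simple graph on $\{x_1,\dots,x_n\}$ with edges $f_1,\dots,f_r$, let $I=I(G)$, let $\phi$ be the presentation matrix of $I$ from its Taylor resolution, and let $\overline{B(\phi)}$ be its reduced Jacobian dual. Then the indecomposable even circuits of $G$ correspond exactly to the binomial minors of $\overline{B(\phi)}$ (determinants $\det M$ of square submatrices $M$ of $\overline{B(\phi)}$) which satisfy the following conditions: (1) the monomials in these binomials are square-free and relatively prime; and (2) the columns of the corresponding submatrices $M$ are pairwise center-distinct. Here the correspondence associates to an even circuit whose successive edges are $f_{a_1},f_{a_2},\dots,f_{a_{2t}}$ the binomial $\prod_{i=1}^t T_{a_{2i}}-\prod_{i=1}^t T_{a_{2i-1}}$ (up to sign). That is: for every indecomposable even circuit of $G$, its binomial is, up to sign, the determinant of a submatrix $M$ of $\overline{B(\phi)}$ satisfying (1) and (2); and conversely, for every square submatrix $M$ of $\overline{B(\phi)}$ whose determinant is a binomial and which satisfies (1) and (2), $\det M$ is, up to sign, the binomial of an indecomposable even circuit of $G$.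
   Context: $\Bbbk$ is an infinite field, $R=\Bbbk[x_1,\dots,x_n]$, $\mathfrak m=(x_1,\dots,x_n)$. $G$ is a finite simple undirected graph whose vertices are identified with the variables $x_1,\dots,x_n$; an edge between $x_i$ and $x_j$ is identified with the monomial $x_ix_j$. The edge ideal is $I(G)=\langle x_ix_j : x_ix_j \text{ is an edge of } G\rangle$, with minimal generators the edges $f_1,\dots,f_r$. New variables $T_1,\dots,T_r$ are introduced, $T_i$ corresponding to $f_i$. Taylor presentation matrix: $\phi$ has rows indexed by $f_1,\dots,f_r$ and columns indexed by the 2-element subsets $\tau$ of $\{f_1,\dots,f_r\}$; the column of $\tau=\{f_j,f_k\}$, $j<k$, has entry $-\operatorname{lcm}(f_j,f_k)/f_j$ in row $f_j$, entry $\operatorname{lcm}(f_j,f_k)/f_k$ in row $f_k$, and $0$ elsewhere. Jacobian dual: $B(\phi)$ is a matrix with entries in $R[T_1,\dots,T_r]$, linear in $T_1,\dots,T_r$, with $[T_1\ \cdots\ T_r]\cdot\phi=[x_1\ \cdots\ x_n]\cdot B(\phi)$; its rows are indexed by $x_1,\dots,x_n$ and its columns by the columns of $\phi$. The reduced Jacobian dual $\overline{B(\phi)}=B(\phi)\otimes R/\mathfrak m$ is obtained by reducing the entries modulo $x_1,\dots,x_n$; it does not depend on the choice of $B(\phi)$. Its nonzero columns come from pairs of edges $f_j,f_k$ sharing a vertex, i.e. from paths of length 2 in $G$. Two nonzero columns of $\overline{B(\phi)}$ are center-distinct if the corresponding paths of length 2 have distinct middle vertices (the middle vertex of the path with edges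 $f_j,f_k$ is the common vertex $\gcd(f_j,f_k)$). A minor is the determinant of a square submatrix; it is binomial if it can be written as the sum or difference of two monomials. A walk is an alternating sequence $v_1,e_1,v_2,\dots,e_{s-1},v_s$ of vertices and edges with $e_i=\{v_i,v_{i+1}\}$; it is closed if $v_1=v_s$; its length is the number of edges traversed, counted with multiplicity. A circuit is a closed walk whose edges are all distinct (vertices may repeat). It is even if its length is even. An even circuit is indecomposable if it cannot be realized as the edge-disjoint union of two smaller even circuits.
   Formalization: Indecomposable means the closed walk, from a suitable start, does not traverse one even circuit and then another edge-disjoint one at the same base vertex; if a mere partition of the edge set into two even circuits counted as decomposing, the converse would be false. *)

theory Defs
  imports "HOL-Library.Poly_Mapping" "Jordan_Normal_Form.Determinant"
    "Jordan_Normal_Form.DL_Submatrix"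
begin

text \<open>Polynomials in variables indexed by natural numbers: finitely supported maps from exponent
  vectors to coefficients. Indices start at 0: the variables of \<open>R\<close> are those with index \<open>< n\<close>, and
  \<open>T i\<close> corresponds to the edge \<open>fs ! i\<close>. The ring \<open>R[T]\<close> is rendered as \<open>'k mpoly mpoly\<close>: the
  outer variables are the \<open>T i\<close>, the inner ones the \<open>x i\<close>.\<close>

type_synonym 'a mpoly = "(nat \<Rightarrow>\<^sub>0 nat) \<Rightarrow>\<^sub>0 'a"

definition monomial :: "(nat \<Rightarrow>\<^sub>0 nat) \<Rightarrow> 'a::comm_ring_1 mpoly" where
  "monomial m = Poly_Mapping.single m 1"

definition pvar :: "nat \<Rightarrow> 'a::comm_ring_1 mpoly" where
  "pvar i = monomial (Poly_Mapping.single i 1)"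

definition pconst :: "'a::comm_ring_1 \<Rightarrow> 'a mpoly" where
  "pconst c = Poly_Mapping.single 0 c"

definition poly_ring :: "nat \<Rightarrow> 'a::comm_ring_1 mpoly set" where
  "poly_ring n = {p. \<forall>m \<in> Poly_Mapping.keys p. Poly_Mapping.keys m \<subseteq> {..<n}}"

lift_definition lcm_exp :: "(nat \<Rightarrow>\<^sub>0 nat) \<Rightarrow> (nat \<Rightarrow>\<^sub>0 nat) \<Rightarrow> nat \<Rightarrow>\<^sub>0 nat" is
  "\<lambda>a b i. max (a i) (b i)"
proof -
  fix a b :: "nat \<Rightarrow> nat"
  assume "finite {i. a i \<noteq> 0}" "finite {i. b i \<noteq> 0}"
  then show "finite {i. max (a i) (b i) \<noteq> 0}"
    by (rule finite_subset[rotated, OF finite_UnI]) auto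
qed


section \<open>Graphs and the Taylor presentation\<close>

text \<open>The list fixes the numbering of the edges (i.e. of the minimal generators of the edge ideal).\<close>

definition simple_graph :: "nat \<Rightarrow> nat set list \<Rightarrow> bool" where
  "simple_graph n fs \<longleftrightarrow> distinct fs \<and> (\<forall>e \<in> set fs. e \<subseteq> {..<n} \<and> card e = 2)"

definition edge_exp :: "nat set \<Rightarrow> nat \<Rightarrow>\<^sub>0 nat" where
  "edge_exp e = (\<Sum>i\<in>e. Poly_Mapping.single i 1)"

definition edge_pairs :: "nat set list \<Rightarrow> (nat \<times> nat) list" where
  "edge_pairs fs = [(j, k). j \<leftarrow> [0..<length fs], k \<leftarrow> [Suc j..<length fs]]"

text \<open>Column \<open>c\<close> belongs to the pair \<open>edge_pairs fs ! c\<close>. The subtraction of exponent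
  vectors is the division of the lcm by one of the two edge monomials.\<close>

definition taylor_matrix :: "nat set list \<Rightarrow> 'k::field mpoly mat" where
  "taylor_matrix fs = mat (length fs) (length (edge_pairs fs)) (\<lambda>(i, c).
     let (j, k) = edge_pairs fs ! c;
         l = lcm_exp (edge_exp (fs ! j)) (edge_exp (fs ! k))
     in if i = j then - monomial (l - edge_exp (fs ! j))
        else if i = k then monomial (l - edge_exp (fs ! k))
        else 0)"


section \<open>The Jacobian dual\<close>

definition linear_form :: "nat \<Rightarrow> nat \<Rightarrow> 'k::field mpoly mpoly \<Rightarrow> bool" where
  "linear_form n r p \<longleftrightarrow>
     Poly_Mapping.keys p \<subseteq> (\<lambda>i. Poly_Mapping.single i 1) ` {..<r} \<and>
     (\<forall>m. Poly_Mapping.lookup p m \<in> poly_ring n)"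

definition jacobian_dual :: "nat \<Rightarrow> 'k::field mpoly mat \<Rightarrow> 'k mpoly mpoly mat \<Rightarrow> bool" where
  "jacobian_dual n \<phi> B \<longleftrightarrow>
     B \<in> carrier_mat n (dim_col \<phi>) \<and>
     (\<forall>i < n. \<forall>c < dim_col \<phi>. linear_form n (dim_row \<phi>) (B $$ (i, c))) \<and>
     mat 1 (dim_row \<phi>) (\<lambda>(_, i). pvar i) * map_mat pconst \<phi> =
     mat 1 n (\<lambda>(_, i). pconst (pvar i)) * B"

text \<open>The residue class of a polynomial of \<open>R\<close> modulo \<open>(x 0, ..., x (n - 1))\<close> is identified with
  its constant coefficient, so the reduced matrix has entries in \<open>k[T]\<close>.\<close>

definition reduced_jacobian_dual :: "'k::field mpoly mpoly mat \<Rightarrow> 'k mpoly mat" where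
  "reduced_jacobian_dual B = map_mat (Poly_Mapping.map (\<lambda>c. Poly_Mapping.lookup c 0)) B"


section \<open>Minors\<close>

definition square_submatrix :: "'a mat \<Rightarrow> nat set \<Rightarrow> nat set \<Rightarrow> 'a mat \<Rightarrow> bool" where
  "square_submatrix A I J M \<longleftrightarrow>
     I \<subseteq> {..<dim_row A} \<and> J \<subseteq> {..<dim_col A} \<and> card I = card J \<and> M = submatrix A I J"

text \<open>The monomials are required to be distinct: otherwise \<open>0 = 1 - 1\<close> would be a
  binomial with square-free, relatively prime monomials.\<close>

definition is_binomial_in :: "'a::comm_ring_1 mpoly \<Rightarrow> (nat \<Rightarrow>\<^sub>0 nat) \<Rightarrow> (nat \<Rightarrow>\<^sub>0 nat) \<Rightarrow> bool" where
  "is_binomial_in d a b \<longleftrightarrow>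
     a \<noteq> b \<and> (d = monomial a + monomial b \<or> d = monomial a - monomial b)"

definition squarefree_exp :: "(nat \<Rightarrow>\<^sub>0 nat) \<Rightarrow> bool" where
  "squarefree_exp a \<longleftrightarrow> (\<forall>i. Poly_Mapping.lookup a i \<le> 1)"

definition coprime_exp :: "(nat \<Rightarrow>\<^sub>0 nat) \<Rightarrow> (nat \<Rightarrow>\<^sub>0 nat) \<Rightarrow> bool" where
  "coprime_exp a b \<longleftrightarrow> Poly_Mapping.keys a \<inter> Poly_Mapping.keys b = {}"

definition squarefree_coprime_binomial :: "'a::comm_ring_1 mpoly \<Rightarrow> bool" where
  "squarefree_coprime_binomial d \<longleftrightarrow>
     (\<exists>a b. is_binomial_in d a b \<and> squarefree_exp a \<and> squarefree_exp b \<and> coprime_exp a b)"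

text \<open>Only meaningful for a nonzero column of the reduced Jacobian dual, where the two edges share
  exactly one vertex.\<close>

definition middle_vertex :: "nat set list \<Rightarrow> nat \<Rightarrow> nat" where
  "middle_vertex fs c = (let (j, k) = edge_pairs fs ! c in the_elem (fs ! j \<inter> fs ! k))"

definition center_distinct :: "nat set list \<Rightarrow> 'a::zero mat \<Rightarrow> nat \<Rightarrow> nat \<Rightarrow> bool" where
  "center_distinct fs A c d \<longleftrightarrow>
     col A c \<noteq> 0\<^sub>v (dim_row A) \<and> col A d \<noteq> 0\<^sub>v (dim_row A) \<and>
     middle_vertex fs c \<noteq> middle_vertex fs d"


section \<open>Circuits\<close>

text \<open>A walk is given by its list of vertices and its list of edge numbers.\<close>

definition walk :: "nat set list \<Rightarrow> nat list \<Rightarrow> nat list \<Rightarrow> bool" where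
  "walk fs vs as \<longleftrightarrow> length vs = Suc (length as) \<and>
     (\<forall>i < length as. as ! i < length fs \<and> fs ! (as ! i) = {vs ! i, vs ! Suc i})"

definition circuit :: "nat set list \<Rightarrow> nat list \<Rightarrow> nat list \<Rightarrow> bool" where
  "circuit fs vs as \<longleftrightarrow> walk fs vs as \<and> hd vs = last vs \<and> as \<noteq> [] \<and> distinct as"

definition even_circuit :: "nat set list \<Rightarrow> nat list \<Rightarrow> nat list \<Rightarrow> bool" where
  "even_circuit fs vs as \<longleftrightarrow> circuit fs vs as \<and> even (length as)"

text \<open>A circuit is a closed walk, and a union of two circuits is meant as a union of closed walks:
  for a suitable starting point, the circuit traverses first the one and then the other of two
  edge-disjoint even circuits with a common base vertex. A mere partition of the set of edges would
  be a weaker requirement. For instance, let \<open>u\<close> and \<open>w\<close> be joined by an edge and by internally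
  disjoint paths \<open>u p w\<close>, \<open>u q w\<close>, \<open>w d e u\<close>. The edges of the circuit \<open>u p w u q w d e u\<close> are those
  of the two 4-cycles \<open>u p w q u\<close> and \<open>u w d e u\<close>, but the circuit does not split at \<open>u\<close> or \<open>w\<close> into
  even circuits; its binomial is the minor with rows \<open>u, w, q, d\<close> and columns \<open>u p w\<close>, \<open>w u q\<close>,
  \<open>q w d\<close>, \<open>d e u\<close>, which has square-free, relatively prime monomials and distinct centers.\<close>

definition union_of_smaller_even_circuits :: "nat set list \<Rightarrow> nat list \<Rightarrow> nat list \<Rightarrow> bool" where
  "union_of_smaller_even_circuits fs vs as \<longleftrightarrow>
     (\<exists>s vs1 as1 vs2 as2.
        even_circuit fs vs1 as1 \<and> even_circuit fs vs2 as2 \<and>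
        length as1 < length as \<and> length as2 < length as \<and>
        set as1 \<inter> set as2 = {} \<and> hd vs1 = hd vs2 \<and>
        rotate s as = as1 @ as2 \<and>
        rotate s (butlast vs) = butlast vs1 @ butlast vs2)"

definition indecomposable_even_circuit :: "nat set list \<Rightarrow> nat list \<Rightarrow> nat list \<Rightarrow> bool" where
  "indecomposable_even_circuit fs vs as \<longleftrightarrow>
     even_circuit fs vs as \<and> \<not> union_of_smaller_even_circuits fs vs as"

definition circuit_binomial :: "nat list \<Rightarrow> 'k::field mpoly" where
  "circuit_binomial as =
     (\<Prod>i < length as div 2. pvar (as ! (2 * i + 1))) - (\<Prod>i < length as div 2. pvar (as ! (2 * i)))"

end

(*
A column of the reduced Jacobian dual given by a path x - v - y has exactly two nonzero entries: up to
a common sign, T_{vy} in row x and - T_{xv} in row y. A submatrix thus behaves like the weighted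
incidence matrix of a graph on its rows, whose edges are labelled by the middle vertices. If its
determinant is a binomial in square-free coprime monomials, this graph is a single cycle u_1, u_2, ...,
and inserting the middle vertices yields a circuit u_1 v_1 u_2 v_2 ... in G; conversely the
cyclic bidiagonal matrix of a circuit has the circuit binomial as its determinant. A circuit splits
into two even circuits at a common base vertex iff it visits some vertex twice at positions of the
same parity, so indecomposability says exactly that the rows u_i and the centers v_i are distinct.
*)

theory Submission
  imports Defs "HOL-Combinatorics.Orbits"
begin

section \<open>The determinant of a cyclic bidiagonal submatrix\<close>

text \<open>Laplace expansion along the last column leaves two triangular minors, one with the
  \<open>p i\<close> on its diagonal and one with the \<open>- q i\<close>. The bound
  \<open>2 \<le> m\<close> keeps the two nonzero rows of that column apart.\<close>

lemma det_cyclic_bidiagonal: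
  fixes N :: "'a::comm_ring_1 mat"
  assumes N: "N \<in> carrier_mat m m" and m: "2 \<le> m"
    and diag: "\<And>i. i < m \<Longrightarrow> N $$ (i, i) = p i"
    and sub: "\<And>i. i < m \<Longrightarrow> N $$ (Suc i mod m, i) = - q i"
    and zero: "\<And>i j. i < m \<Longrightarrow> j < m \<Longrightarrow> j \<noteq> i \<Longrightarrow> j \<noteq> Suc i mod m \<Longrightarrow> N $$ (j, i) = 0"
  shows "det N = (\<Prod>i<m. p i) - (\<Prod>i<m. q i)"
proof -
  obtain k where k: "m = Suc k" "0 < k"
    using m by (cases m) auto
  have "det N = (\<Sum>i<m. N $$ (i, k) * cofactor N i k)"
    using laplace_expansion_column[OF N, of k] k by simp
  also have "\<dots> = (\<Sum>i\<in>{0, k}. N $$ (i, k) * cofactor N i k)"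
    using zero[of k] k by (intro sum.mono_neutral_right) auto
  also have "\<dots> = - q k * cofactor N 0 k + p k * cofactor N k k"
    using diag[of k] sub[of k] k by simp
  also have "cofactor N k k = (\<Prod>i<k. p i)"
  proof -
    have "det (mat_delete N k k) = prod_list (diag_mat (mat_delete N k k))"
    proof (rule det_lower_triangular)
      fix i j :: nat assume "i < j" "j < k"
      with zero[of j i] k N show "mat_delete N k k $$ (i, j) = 0"
        by (simp add: mat_delete_def)
    next
      show "mat_delete N k k \<in> carrier_mat k k"
        using N k mat_delete_carrier[of N m m k k] by simp
    qed
    also have "\<dots> = (\<Prod>i<k. p i)"
      using N k diag by (simp add: prod_list_diag_prod mat_delete_def atLeast0LessThan)
    finally show ?thesis
      by (simp add: cofactor_def)
  qed
  \<comment> \<open>The sign \<open>(-1) ^ k\<close> of the cofactor cancels against the signs of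
    the \<open>k\<close> diagonal entries, so the formula does not depend on the parity of
    \<open>m\<close>.\<close>
  also have "cofactor N 0 k = (\<Prod>i<k. q i)"
  proof -
    have sub': "N $$ (Suc i, i) = - q i" if "i < k" for i
      using sub[of i] that k by simp
    have "det (mat_delete N 0 k) = prod_list (diag_mat (mat_delete N 0 k))"
    proof (rule det_upper_triangular)
      show "upper_triangular (mat_delete N 0 k)"
        using zero k N by (auto simp: mat_delete_def)
      show "mat_delete N 0 k \<in> carrier_mat k k"
        using N k mat_delete_carrier[of N m m 0 k] by simp
    qed
    also have "\<dots> = (\<Prod>i<k. - q i)"
      using N k sub' by (simp add: prod_list_diag_prod mat_delete_def atLeast0LessThan)
    finally show ?thesis
      by (simp add: cofactor_def prod_uminus mult.assoc[symmetric] power_add[symmetric])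
  qed
  finally show ?thesis
    by (simp add: k mult.commute)
qed

text \<open>Transposition turns the permutation of the columns into one of rows.\<close>

lemma det_permute_rows_columns:
  fixes A :: "'a::comm_ring_1 mat"
  assumes A: "A \<in> carrier_mat n n" and p: "p permutes {..<n}" and q: "q permutes {..<n}"
  shows "det (mat n n (\<lambda>(i, j). A $$ (p i, q j))) = signof p * signof q * det A"
proof -
  let ?B = "mat n n (\<lambda>(i, j). transpose_mat A $$ (q i, j))"
  have less: "p i < n" "q i < n" if "i < n" for i
    using permutes_in_image[OF p, of i] permutes_in_image[OF q, of i] that by auto
  have "mat n n (\<lambda>(i, j). A $$ (p i, q j)) = mat n n (\<lambda>(i, j). transpose_mat ?B $$ (p i, j))"
    using A less by (intro eq_matI) auto
  also have "det \<dots> = signof p * det (transpose_mat ?B)"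
    using p by (intro det_permute_rows) (auto simp: atLeast0LessThan)
  also have "det (transpose_mat ?B) = det ?B"
    by (rule det_transpose) auto
  also have "\<dots> = signof q * det (transpose_mat A)"
    using A q by (intro det_permute_rows) (auto simp: atLeast0LessThan)
  also have "det (transpose_mat A) = det A"
    using A by (rule det_transpose)
  finally show ?thesis
    by (simp add: mult.assoc)
qed

section \<open>Submatrices listed in an arbitrary order\<close>

lemma bij_betw_pick:
  assumes "finite I"
  shows "bij_betw (pick I) {..<card I} I"
proof -
  have "inj_on (pick I) {..<card I}"
    by (intro linorder_inj_onI') (metis lessThan_iff less_irrefl pick_mono_le)
  moreover have "pick I ` {..<card I} \<subseteq> I"
    by (auto simp: pick_in_set_le)
  ultimately show ?thesis
    using assms by (simp add: bij_betw_def card_subset_eq card_image)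
qed

lemma submatrix_subset:
  assumes "I \<subseteq> {..<dim_row A}" "J \<subseteq> {..<dim_col A}"
  shows "submatrix A I J = mat (card I) (card J) (\<lambda>(i, j). A $$ (pick I i, pick J j))"
proof -
  have "{i. i < dim_row A \<and> i \<in> I} = I" "{j. j < dim_col A \<and> j \<in> J} = J"
    using assms by auto
  then show ?thesis
    by (simp add: submatrix_def)
qed

text \<open>A submatrix lists its rows increasingly, a cycle lists them in its own order
  \<open>u\<close>; \<open>\<sigma>\<close> compares the two enumerations.\<close>

lemma pick_reindex:
  assumes u: "inj_on u {..<m::nat}"
  obtains \<sigma> where "\<sigma> permutes {..<m}" "\<And>i. i < m \<Longrightarrow> pick (u ` {..<m}) i = u (\<sigma> i)"
proof -
  let ?I = "u ` {..<m}"
  define \<sigma> where "\<sigma> i = (if i < m then inv_into {..<m} u (pick ?I i) else i)" for i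
  have card: "card ?I = m"
    using u by (simp add: card_image)
  have "bij_betw (inv_into {..<m} u \<circ> pick ?I) {..<m} {..<m}"
    using bij_betw_pick[of ?I] u
    by (intro bij_betw_trans[where B = ?I] bij_betw_inv_into) (auto simp: card bij_betw_def)
  then have "bij_betw \<sigma> {..<m} {..<m}"
    by (rule bij_betw_cong[THEN iffD1, rotated]) (simp add: \<sigma>_def)
  then have "\<sigma> permutes {..<m}"
    by (rule bij_imp_permutes) (simp add: \<sigma>_def)
  moreover have "pick ?I i = u (\<sigma> i)" if "i < m" for i
    using that pick_in_set_le[of i ?I] card by (simp add: \<sigma>_def f_inv_into_f)
  ultimately show ?thesis
    using that by blast
qed

lemma sign_eq_or: "sign p = 1 \<or> sign p = -1"
  by (rule sign_cases[of p]) auto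

text \<open>Listing rows and columns along the cycle gives a cyclic bidiagonal matrix. The two
  reorderings and the column signs \<open>s i\<close> only contribute a global sign.\<close>

lemma det_submatrix_cycle:
  fixes A :: "'a::comm_ring_1 mat"
  assumes m: "2 \<le> m"
    and u: "inj_on u {..<m}" "u ` {..<m} \<subseteq> {..<dim_row A}"
    and c: "inj_on c {..<m}" "c ` {..<m} \<subseteq> {..<dim_col A}"
    and s: "\<And>i. i < m \<Longrightarrow> s i = 1 \<or> s i = - 1"
    and diag: "\<And>i. i < m \<Longrightarrow> A $$ (u i, c i) = s i * p i"
    and sub: "\<And>i. i < m \<Longrightarrow> A $$ (u (Suc i mod m), c i) = - (s i * q i)"
    and zero: "\<And>i x. i < m \<Longrightarrow> x < dim_row A \<Longrightarrow> x \<noteq> u i \<Longrightarrow> x \<noteq> u (Suc i mod m) \<Longrightarrow> A $$ (x, c i) = 0"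
    and d: "d = (\<Prod>i<m. p i) - (\<Prod>i<m. q i)"
  shows "det (submatrix A (u ` {..<m}) (c ` {..<m})) = d \<or>
    det (submatrix A (u ` {..<m}) (c ` {..<m})) = - d"
proof -
  let ?N = "mat m m (\<lambda>(i, j). A $$ (u i, c j))"
  obtain \<sigma> where \<sigma>: "\<sigma> permutes {..<m}" "\<And>i. i < m \<Longrightarrow> pick (u ` {..<m}) i = u (\<sigma> i)"
    by (rule pick_reindex[OF u(1)]) blast
  obtain \<tau> where \<tau>: "\<tau> permutes {..<m}" "\<And>i. i < m \<Longrightarrow> pick (c ` {..<m}) i = c (\<tau> i)"
    by (rule pick_reindex[OF c(1)]) blast
  have less: "\<sigma> i < m" "\<tau> i < m" if "i < m" for i
    using permutes_in_image[OF \<sigma>(1), of i] permutes_in_image[OF \<tau>(1), of i] that by auto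
  have "submatrix A (u ` {..<m}) (c ` {..<m}) = mat m m (\<lambda>(i, j). ?N $$ (\<sigma> i, \<tau> j))"
    using u c \<sigma>(2) \<tau>(2) less by (subst submatrix_subset) (auto simp: card_image intro!: eq_matI)
  then have "det (submatrix A (u ` {..<m}) (c ` {..<m})) = signof \<sigma> * signof \<tau> * det ?N"
    using \<sigma>(1) \<tau>(1) by (simp add: det_permute_rows_columns)
  also have "det ?N = (\<Prod>i<m. s i * p i) - (\<Prod>i<m. s i * q i)"
  proof (rule det_cyclic_bidiagonal[OF _ m])
    fix i j assume ij: "i < m" "j < m" "j \<noteq> i" "j \<noteq> Suc i mod m"
    then have "u j \<noteq> u i" "u j \<noteq> u (Suc i mod m)"
      using u(1) by (auto simp: inj_on_def)
    moreover have "u j < dim_row A"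
      using u(2) ij by auto
    ultimately show "?N $$ (j, i) = 0"
      using ij zero by simp
  qed (use diag sub in auto)
  also have "\<dots> = (\<Prod>i<m. s i) * d"
    by (simp add: d prod.distrib right_diff_distrib)
  finally have "det (submatrix A (u ` {..<m}) (c ` {..<m})) = signof \<sigma> * signof \<tau> * (\<Prod>i<m. s i) * d"
    by (simp add: mult.assoc)
  moreover have "(\<Prod>i<m. s i) = 1 \<or> (\<Prod>i<m. s i) = - 1"
  proof -
    have "(\<Prod>i<k. s i) = 1 \<or> (\<Prod>i<k. s i) = - 1" if "k \<le> m" for k
      using that
    proof (induction k)
      case (Suc k)
      with s[of k] show ?case by auto
    qed simp
    then show ?thesis by simp
  qed
  ultimately show ?thesis
    using sign_eq_or[of \<sigma>] sign_eq_or[of \<tau>] by auto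
qed

section \<open>The entries of the reduced Jacobian dual\<close>

declare One_nat_def [simp del]

lemma lookup_single_mult:
  fixes g :: "'b::cancel_comm_monoid_add \<Rightarrow>\<^sub>0 'a::comm_semiring_0"
  shows "Poly_Mapping.lookup (Poly_Mapping.single a x * g) (a + d) = x * Poly_Mapping.lookup g d"
  by (simp add: lookup_mult lookup_single when_mult)

lemma lookup_pconst_mult:
  "Poly_Mapping.lookup (pconst x * g) m = x * Poly_Mapping.lookup g m"
  unfolding pconst_def using lookup_single_mult[of 0 x g m] by simp

lemma single_1_eq_iff [simp]:
  "Poly_Mapping.single i (1::nat) = Poly_Mapping.single j 1 \<longleftrightarrow> i = j"
  by (metis lookup_single_eq lookup_single_not_eq zero_neq_one)

text \<open>A variable divides another variable only if they are equal, and then the cofactor is the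
  constant monomial. This extracts linear coefficients.\<close>

lemma lookup_pvar_mult_single:
  "Poly_Mapping.lookup (pvar i * g) (Poly_Mapping.single j 1) =
     (if i = j then Poly_Mapping.lookup g 0 else 0)"
proof (cases "i = j")
  case True
  then show ?thesis
    unfolding pvar_def monomial_def
    using lookup_single_mult[of "Poly_Mapping.single j 1" 1 g 0] by simp
next
  case False
  have "Poly_Mapping.single j 1 \<noteq> Poly_Mapping.single i (1::nat) + q" for q
  proof
    assume "Poly_Mapping.single j 1 = Poly_Mapping.single i (1::nat) + q"
    then have "Poly_Mapping.lookup (Poly_Mapping.single j (1::nat)) i =
        Poly_Mapping.lookup (Poly_Mapping.single i (1::nat) + q) i"
      by simp
    with False show False
      by (simp add: lookup_add lookup_single)
  qed
  with False show ?thesis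
    by (simp add: pvar_def monomial_def lookup_mult lookup_single when_mult)
qed

lemma lookup_pvar_single:
  "Poly_Mapping.lookup (pvar i) (Poly_Mapping.single j 1) = (if i = j then 1 else 0)"
  by (simp add: pvar_def monomial_def lookup_single)

text \<open>Comparing the coefficients of \<open>T e\<close> times \<open>x\<close> in the defining
  equation determines the constant coefficients of \<open>B\<close>, although \<open>B\<close>
  itself is not unique. All other monomials are excluded by \<open>linear_form\<close>.\<close>

lemma lookup_reduced_jacobian_dual:
  fixes \<phi> :: "'k::field mpoly mat"
  assumes B: "jacobian_dual n \<phi> B" and x: "x < n" and c: "c < dim_col \<phi>"
  shows "Poly_Mapping.lookup (reduced_jacobian_dual B $$ (x, c)) m =
    (if m \<in> (\<lambda>e. Poly_Mapping.single e 1) ` {..<dim_row \<phi>}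
     then Poly_Mapping.lookup (\<phi> $$ (THE e. m = Poly_Mapping.single e 1, c)) (Poly_Mapping.single x 1) else 0)"
proof -
  let ?r = "dim_row \<phi>"
  have dim: "dim_row B = n" "dim_col B = dim_col \<phi>"
    using B by (auto simp: jacobian_dual_def)
  have A: "Poly_Mapping.lookup (reduced_jacobian_dual B $$ (x, c)) m =
      Poly_Mapping.lookup (Poly_Mapping.lookup (B $$ (x, c)) m) 0"
    using x c dim by (simp add: reduced_jacobian_dual_def Poly_Mapping.map.rep_eq when_def)
  show ?thesis
  proof (cases "m \<in> (\<lambda>e. Poly_Mapping.single e 1) ` {..<?r}")
    case True
    then obtain e where e: "e < ?r" "m = Poly_Mapping.single e 1"
      by auto
    have "mat 1 ?r (\<lambda>(_, i). pvar i) * map_mat pconst \<phi> = mat 1 n (\<lambda>(_, i). pconst (pvar i)) * B"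
      using B by (simp add: jacobian_dual_def)
    from arg_cong[OF this, of "\<lambda>M. M $$ (0, c)"]
    have "(\<Sum>i<?r. pvar i * pconst (\<phi> $$ (i, c))) = (\<Sum>i<n. pconst (pvar i) * B $$ (i, c))"
      using c dim by (simp add: scalar_prod_def atLeast0LessThan)
    \<comment> \<open>Coefficients of \<open>T e\<close>: on the left only row \<open>e\<close> of
      \<open>\<phi>\<close> remains.\<close>
    from arg_cong[OF this, of "\<lambda>p. Poly_Mapping.lookup p m"]
    have "(\<Sum>i<?r. if i = e then Poly_Mapping.lookup (pconst (\<phi> $$ (i, c))) 0 else 0) =
        (\<Sum>i<n. pvar i * Poly_Mapping.lookup (B $$ (i, c)) m)"
      unfolding e(2) by (simp add: lookup_sum lookup_pvar_mult_single lookup_pconst_mult)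
    then have "\<phi> $$ (e, c) = (\<Sum>i<n. pvar i * Poly_Mapping.lookup (B $$ (i, c)) m)"
      using e by (simp add: pconst_def)
    \<comment> \<open>Coefficients of the variable \<open>x\<close>: on the right only the constant
      coefficient from row \<open>x\<close> of \<open>B\<close> remains.\<close>
    from arg_cong[OF this, of "\<lambda>p. Poly_Mapping.lookup p (Poly_Mapping.single x 1)"]
    have "Poly_Mapping.lookup (\<phi> $$ (e, c)) (Poly_Mapping.single x 1) =
        (\<Sum>i<n. if i = x then Poly_Mapping.lookup (Poly_Mapping.lookup (B $$ (i, c)) m) 0 else 0)"
      by (simp add: lookup_sum lookup_pvar_mult_single)
    also have "\<dots> = Poly_Mapping.lookup (Poly_Mapping.lookup (B $$ (x, c)) m) 0"
      using x by simp
    finally show ?thesis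
      using e A by simp
  next
    case False
    have "Poly_Mapping.keys (B $$ (x, c)) \<subseteq> (\<lambda>e. Poly_Mapping.single e 1) ` {..<?r}"
      using B x c by (auto simp: jacobian_dual_def linear_form_def)
    with False have "Poly_Mapping.lookup (B $$ (x, c)) m = 0"
      by (meson in_keys_iff subsetD)
    with False A show ?thesis
      by simp
  qed
qed

section \<open>Linear terms of the Taylor presentation\<close>

lemma lookup_edge_exp:
  assumes "finite e"
  shows "Poly_Mapping.lookup (edge_exp e) i = (if i \<in> e then 1 else 0)"
  using assms by (simp add: edge_exp_def lookup_sum lookup_single when_def)

text \<open>Edge monomials are square-free, so the quotient of the lcm by \<open>e\<close> is the
  product of the variables in \<open>f - e\<close>.\<close>

lemma lcm_exp_minus_edge_exp_eq_single:
  assumes "finite e" "finite f"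
  shows "lcm_exp (edge_exp e) (edge_exp f) - edge_exp e = Poly_Mapping.single x 1 \<longleftrightarrow> f - e = {x}"
proof -
  have "Poly_Mapping.lookup (lcm_exp (edge_exp e) (edge_exp f) - edge_exp e) i = (if i \<in> f - e then 1 else 0)" for i
    using assms by (simp add: lookup_minus lcm_exp.rep_eq lookup_edge_exp)
  then have "lcm_exp (edge_exp e) (edge_exp f) - edge_exp e = Poly_Mapping.single x 1 \<longleftrightarrow>
      (\<forall>i. (if i \<in> f - e then 1 else 0 :: nat) = (if i = x then 1 else 0))"
    unfolding poly_mapping_eq_iff fun_eq_iff lookup_single when_def by (simp only: eq_commute[of x])
  also have "\<dots> \<longleftrightarrow> (\<forall>i. i \<in> f - e \<longleftrightarrow> i = x)"
    by (intro all_cong1) (simp split: if_split)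
  also have "\<dots> \<longleftrightarrow> f - e = {x}"
    by blast
  finally show ?thesis .
qed

lemma lcm_exp_commute: "lcm_exp a b = lcm_exp b a"
  by transfer (simp add: max.commute)

lemma set_edge_pairs: "set (edge_pairs fs) = {(j, k). j < k \<and> k < length fs}"
  by (force simp: edge_pairs_def)

text \<open>Only Taylor entries that are a single variable up to sign survive the reduction. The
  quotient by \<open>fs ! k\<close> equals \<open>x\<close> when \<open>x\<close> is the vertex of
  \<open>fs ! j\<close> outside \<open>fs ! k\<close>; hence row \<open>x\<close> carries the
  variable of the edge not containing \<open>x\<close>.\<close>

lemma reduced_jacobian_dual_taylor:
  fixes B :: "'k::field mpoly mpoly mat"
  assumes G: "simple_graph n fs" and B: "jacobian_dual n (taylor_matrix fs) B"
    and x: "x < n" and c: "c < length (edge_pairs fs)" and jk: "edge_pairs fs ! c = (j, k)"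
  shows "reduced_jacobian_dual B $$ (x, c) =
    (if fs ! j - fs ! k = {x} then pvar k else if fs ! k - fs ! j = {x} then - pvar j else 0)"
proof (rule poly_mapping_eqI)
  fix m
  have jk': "j < k" "k < length fs"
    using nth_mem[OF c] jk by (auto simp: set_edge_pairs)
  have "finite (fs ! i)" if "i < length fs" for i
    using G nth_mem[OF that] by (auto simp: simple_graph_def intro: finite_subset)
  then have fin: "finite (fs ! j)" "finite (fs ! k)"
    using jk' by auto
  have \<phi>: "Poly_Mapping.lookup ((taylor_matrix fs :: 'k mpoly mat) $$ (e, c)) (Poly_Mapping.single x 1) =
      (if e = j \<and> fs ! k - fs ! j = {x} then - 1 else if e = k \<and> fs ! j - fs ! k = {x} then 1 else 0)"
    if "e < length fs" for e
  proof -
    let ?l = "lcm_exp (edge_exp (fs ! j)) (edge_exp (fs ! k))"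
    have "(taylor_matrix fs :: 'k mpoly mat) $$ (e, c) =
        (if e = j then - monomial (?l - edge_exp (fs ! j))
         else if e = k then monomial (?l - edge_exp (fs ! k)) else 0)"
      using that c jk by (simp add: taylor_matrix_def)
    moreover have "?l - edge_exp (fs ! j) = Poly_Mapping.single x 1 \<longleftrightarrow> fs ! k - fs ! j = {x}"
      using fin by (rule lcm_exp_minus_edge_exp_eq_single)
    moreover have "?l - edge_exp (fs ! k) = Poly_Mapping.single x 1 \<longleftrightarrow> fs ! j - fs ! k = {x}"
      unfolding lcm_exp_commute[of "edge_exp (fs ! j)"]
      using fin(2,1) by (rule lcm_exp_minus_edge_exp_eq_single)
    ultimately show ?thesis
      using jk' by (auto simp: monomial_def lookup_single when_def)
  qed
  have dims: "dim_row (taylor_matrix fs :: 'k mpoly mat) = length fs"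
    "dim_col (taylor_matrix fs :: 'k mpoly mat) = length (edge_pairs fs)"
    by (auto simp: taylor_matrix_def)
  show "Poly_Mapping.lookup (reduced_jacobian_dual B $$ (x, c)) m = Poly_Mapping.lookup
      (if fs ! j - fs ! k = {x} then pvar k else if fs ! k - fs ! j = {x} then - pvar j else 0) m"
  proof (cases "m \<in> (\<lambda>e. Poly_Mapping.single e 1) ` {..<length fs}")
    case True
    then obtain e where e: "e < length fs" "m = Poly_Mapping.single e 1"
      by auto
    have "Poly_Mapping.lookup (reduced_jacobian_dual B $$ (x, c)) m =
        Poly_Mapping.lookup ((taylor_matrix fs :: 'k mpoly mat) $$ (e, c)) (Poly_Mapping.single x 1)"
      using e c by (simp add: lookup_reduced_jacobian_dual[OF B x] dims)
    also have "\<dots> = Poly_Mapping.lookup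
        (if fs ! j - fs ! k = {x} then pvar k else if fs ! k - fs ! j = {x} then - pvar j else 0) m"
      unfolding \<phi>[OF e(1)] e(2) using jk'(1)
      by (cases "fs ! j - fs ! k = {x}"; cases "fs ! k - fs ! j = {x}")
        (auto simp: lookup_pvar_single)
    finally show ?thesis .
  next
    case False
    then have "m \<noteq> Poly_Mapping.single j 1" "m \<noteq> Poly_Mapping.single k 1"
      using jk' by auto
    then show ?thesis
      using False c by (simp add: lookup_reduced_jacobian_dual[OF B x] dims pvar_def monomial_def
          lookup_single_not_eq)
  qed
qed

section \<open>Square-free coprime binomial determinants\<close>

text \<open>Such a sum is the exponent vector of the product of the variables \<open>g j\<close>; a
  repeated value of \<open>g\<close> raises an exponent.\<close>

lemma lookup_sum_single:
  assumes "finite S"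
  shows "Poly_Mapping.lookup (\<Sum>j\<in>S. Poly_Mapping.single (g j) 1) x = card {j \<in> S. g j = x}"
  using assms by (simp add: lookup_sum lookup_single when_def sum.If_cases Int_def)

lemma keys_sum_single:
  assumes "finite S"
  shows "Poly_Mapping.keys (\<Sum>j\<in>S. Poly_Mapping.single (g j) (1::nat)) = g ` S"
proof (rule Set.set_eqI)
  fix x
  show "x \<in> Poly_Mapping.keys (\<Sum>j\<in>S. Poly_Mapping.single (g j) (1::nat)) \<longleftrightarrow> x \<in> g ` S"
    using assms unfolding in_keys_iff lookup_sum_single[OF assms] by auto
qed

lemma squarefree_sum_single:
  assumes "finite S"
  shows "squarefree_exp (\<Sum>j\<in>S. Poly_Mapping.single (g j) 1) \<longleftrightarrow> inj_on g S"
  using assms unfolding squarefree_exp_def lookup_sum_single[OF assms] inj_on_def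
  by (auto simp: One_nat_def card_le_Suc0_iff_eq)

text \<open>The sign is stored as the coefficient, so that each term of Leibniz' formula is visibly
  a single monomial.\<close>

lemma prod_signed_pvar:
  fixes f :: "'b \<Rightarrow> 'a::comm_ring_1 mpoly"
  assumes "finite S" "\<And>j. j \<in> S \<Longrightarrow> f j = pvar (g j) \<or> f j = - pvar (g j)"
  shows "\<exists>s. (s = 1 \<or> s = - 1) \<and> prod f S = Poly_Mapping.single (\<Sum>j\<in>S. Poly_Mapping.single (g j) 1) s"
  using assms
proof (induction S rule: finite_induct)
  case empty
  then show ?case by (auto intro!: exI[of _ 1])
next
  case (insert x S)
  then obtain s where s: "s = 1 \<or> s = - 1"
    "prod f S = Poly_Mapping.single (\<Sum>j\<in>S. Poly_Mapping.single (g j) 1) s"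
    by auto
  have "f x = Poly_Mapping.single (Poly_Mapping.single (g x) 1) 1 \<or>
      f x = Poly_Mapping.single (Poly_Mapping.single (g x) 1) (- 1)"
    using insert.prems[of x] by (auto simp: pvar_def monomial_def single_uminus)
  then obtain t where t: "t = 1 \<or> t = - 1" "f x = Poly_Mapping.single (Poly_Mapping.single (g x) 1) t"
    by auto
  have "prod f (insert x S) = Poly_Mapping.single (\<Sum>j\<in>insert x S. Poly_Mapping.single (g j) 1) (t * s)"
    using insert.hyps s t by (simp add: mult_single)
  moreover have "t * s = 1 \<or> t * s = - 1"
    using s t by auto
  ultimately show ?case by blast
qed

text \<open>The powers of \<open>f\<close> up to the first return to \<open>0\<close> list the orbit
  without repetition, so the return time is the size \<open>k\<close> of the orbit.\<close>

lemma cycle_of_permutes: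
  assumes f: "f permutes {..<k}" and k: "0 < k" and cyc: "{..<k} \<subseteq> orbit f 0"
  shows "bij_betw (\<lambda>i. (f ^^ i) 0) {..<k} {..<k}" "(f ^^ k) 0 = 0"
proof -
  have "permutation f"
    using f by (auto simp: permutation_permutes)
  then have self: "0 \<in> orbit f 0"
    by (rule permutation_self_in_orbit)
  have orb: "orbit f 0 = {..<k}"
    using cyc permutes_orbit_subset[OF f, of 0] k by auto
  let ?d = "funpow_dist1 f 0 0"
  have inj: "inj_on (\<lambda>i. (f ^^ i) 0) {0..<?d}"
    using self by (rule inj_on_funpow_dist1)
  have img: "(\<lambda>i. (f ^^ i) 0) ` {0..<?d} = {..<k}"
    using orbit_conv_funpow_dist1[OF self] orb by simp
  have d: "?d = k"
    using card_image[OF inj] unfolding img by simp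
  show "bij_betw (\<lambda>i. (f ^^ i) 0) {..<k} {..<k}"
    using inj img unfolding d by (simp add: bij_betw_def atLeast0LessThan)
  show "(f ^^ k) 0 = 0"
    using funpow_dist1_prop[OF self] unfolding d .
qed

text \<open>Leibniz' formula cannot cancel here: if two terms of the expansion are \<open>\<plusminus>a\<close> and \<open>\<plusminus>b\<close>, all the
  other terms choose in every column between the factors of \<open>a\<close> and \<open>b\<close>, and since these factors are
  pairwise distinct variables, the resulting monomials are pairwise distinct. So there are no other
  terms, which forces the permutation leading from the one to the other to be a single cycle.\<close>

lemma cycle_of_binomial_det:
  fixes M :: "'a::comm_ring_1 mpoly mat"
  assumes M: "M \<in> carrier_mat k k"
    and entry: "\<And>i j. i < k \<Longrightarrow> j < k \<Longrightarrow> M $$ (i, j) \<noteq> 0 \<Longrightarrow>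
      M $$ (i, j) = pvar (e i j) \<or> M $$ (i, j) = - pvar (e i j)"
    and two: "\<And>x y z j. x < k \<Longrightarrow> y < k \<Longrightarrow> z < k \<Longrightarrow> j < k \<Longrightarrow>
      M $$ (x, j) \<noteq> 0 \<Longrightarrow> M $$ (y, j) \<noteq> 0 \<Longrightarrow> M $$ (z, j) \<noteq> 0 \<Longrightarrow> x \<noteq> y \<Longrightarrow> z = x \<or> z = y"
    and det: "squarefree_coprime_binomial (det M)"
  obtains u c where "2 \<le> k" "bij_betw u {..<k} {..<k}" "bij_betw c {..<k} {..<k}"
    "\<And>i. i < k \<Longrightarrow> M $$ (u i, c i) \<noteq> 0" "\<And>i. i < k \<Longrightarrow> M $$ (u (Suc i mod k), c i) \<noteq> 0"
    "inj_on (\<lambda>i. e (u i) (c i)) {..<k}" "inj_on (\<lambda>i. e (u (Suc i mod k)) (c i)) {..<k}"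
    "\<And>i j. i < k \<Longrightarrow> j < k \<Longrightarrow> e (u i) (c i) \<noteq> e (u (Suc j mod k)) (c j)"
proof -
  \<comment> \<open>A permutation \<open>r\<close> chooses the row \<open>r j\<close> in column
    \<open>j\<close>; \<open>W r\<close> is its Leibniz term, \<open>supp r\<close> says that no
    factor vanishes, and \<open>E r\<close> is the exponent vector.\<close>
  define supp where "supp r \<longleftrightarrow> (\<forall>j<k. M $$ (r j, j) \<noteq> 0)" for r
  define E where "E r = (\<Sum>j<k. Poly_Mapping.single (e (r j) j) (1::nat))" for r
  define W where "W r = signof r * (\<Prod>j<k. M $$ (r j, j))" for r
  let ?P = "{r. r permutes {..<k}}"
  have detW: "det M = (\<Sum>r\<in>?P. W r)"
    unfolding W_def using det_col[OF M] by (simp add: atLeast0LessThan)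
  have W0: "W r = 0" if r: "\<not> supp r" for r
  proof -
    obtain j where "j < k" "M $$ (r j, j) = 0"
      using r by (auto simp: supp_def)
    then have "(\<Prod>j<k. M $$ (r j, j)) = 0"
      by (intro prod_zero) auto
    then show ?thesis
      by (simp add: W_def)
  qed
  have W1: "\<exists>s. (s = 1 \<or> s = - 1) \<and> W r = Poly_Mapping.single (E r) s" if "r permutes {..<k}" "supp r" for r
  proof -
    have "\<exists>s. (s = 1 \<or> s = - 1) \<and> (\<Prod>j<k. M $$ (r j, j)) = Poly_Mapping.single (E r) s"
      unfolding E_def
    proof (rule prod_signed_pvar)
      fix j assume j: "j \<in> {..<k}"
      then have "r j < k"
        using permutes_in_image[OF that(1), of j] by simp
      with j that(2) show "M $$ (r j, j) = pvar (e (r j) j) \<or> M $$ (r j, j) = - pvar (e (r j) j)"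
        using entry[of "r j" j] by (simp add: supp_def)
    qed simp
    then obtain s where "s = 1 \<or> s = - 1" "(\<Prod>j<k. M $$ (r j, j)) = Poly_Mapping.single (E r) s"
      by blast
    moreover have "sign r = 1 \<or> sign r = - 1"
      by (rule sign_cases[of r]) auto
    ultimately show ?thesis
      by (auto simp: W_def single_uminus)
  qed
  obtain a b where ab: "a \<noteq> b" "det M = monomial a + monomial b \<or> det M = monomial a - monomial b"
    and sq: "squarefree_exp a" "squarefree_exp b" and cop: "coprime_exp a b"
    using det by (auto simp: squarefree_coprime_binomial_def is_binomial_in_def)
  \<comment> \<open>A monomial of the determinant must occur in some Leibniz term; applied to
    \<open>a\<close> and \<open>b\<close>, this yields \<open>p\<close> and
    \<open>q\<close>.\<close>
  have "\<exists>r. r permutes {..<k} \<and> supp r \<and> E r = m" if m: "Poly_Mapping.lookup (det M) m \<noteq> 0" for m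
  proof -
    obtain r where r: "r \<in> ?P" "Poly_Mapping.lookup (W r) m \<noteq> 0"
      using m unfolding detW lookup_sum by (meson sum.neutral)
    then have "supp r"
      using W0 by fastforce
    with r W1[of r] show ?thesis
      by (auto simp: lookup_single when_def split: if_splits)
  qed
  moreover have "Poly_Mapping.lookup (det M) a \<noteq> 0" "Poly_Mapping.lookup (det M) b \<noteq> 0"
    using ab by (auto simp: monomial_def lookup_add lookup_minus lookup_single)
  ultimately obtain p q where p: "p permutes {..<k}" "supp p" "E p = a"
    and q: "q permutes {..<k}" "supp q" "E q = b"
    by metis
  have less: "p j < k" "q j < k" if "j < k" for j
    using permutes_in_image[OF p(1), of j] permutes_in_image[OF q(1), of j] that by auto
  have injp: "inj_on (\<lambda>j. e (p j) j) {..<k}" and injq: "inj_on (\<lambda>j. e (q j) j) {..<k}"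
    using sq p(3) q(3) unfolding E_def by (auto simp: squarefree_sum_single)
  have disj: "e (p i) i \<noteq> e (q j) j" if "i < k" "j < k" for i j
    using that cop unfolding p(3)[symmetric] q(3)[symmetric] E_def coprime_exp_def
    by (auto simp: keys_sum_single)
  have pq: "p j \<noteq> q j" if "j < k" for j
    using disj[of j j] that by metis
  have choice: "r j = p j \<or> r j = q j" if "r permutes {..<k}" "supp r" "j < k" for r j
    using two[of "p j" "q j" "r j" j] less[of j] permutes_in_image[OF that(1), of j] that p(2) q(2)
      pq[of j] by (auto simp: supp_def)
  \<comment> \<open>Each variable in the monomial reveals its column and whether \<open>p\<close> or
    \<open>q\<close> was followed there.\<close>
  have E_inj: "r = r'" if "r permutes {..<k}" "supp r" "r' permutes {..<k}" "supp r'" "E r = E r'" for r r'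
  proof
    fix j
    show "r j = r' j"
    proof (cases "j < k")
      case True
      then have "e (r j) j \<in> (\<lambda>j. e (r' j) j) ` {..<k}"
        using that(5) keys_sum_single[of "{..<k}" "\<lambda>j. e (r j) j"] keys_sum_single[of "{..<k}" "\<lambda>j. e (r' j) j"]
        unfolding E_def by auto
      then obtain j' where j': "j' < k" "e (r j) j = e (r' j') j'"
        by auto
      then show ?thesis
        using choice[OF that(1,2) True] choice[OF that(3,4) j'(1)] disj[of j j'] disj[of j' j]
          inj_onD[OF injp, of j j'] inj_onD[OF injq, of j j'] True by auto
    next
      case False
      with that(1,3) show ?thesis
        by (simp add: permutes_not_in)
    qed
  qed
  \<comment> \<open>By \<open>E_inj\<close> no other term has the exponent \<open>E r\<close>, so it
    survives with coefficient 1 or -1 and must be \<open>a\<close> or \<open>b\<close>.\<close>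
  have only: "r = p \<or> r = q" if r: "r permutes {..<k}" "supp r" for r
  proof -
    have "Poly_Mapping.lookup (det M) (E r) = (\<Sum>x\<in>?P. Poly_Mapping.lookup (W x) (E r))"
      unfolding detW lookup_sum ..
    also have "\<dots> = (\<Sum>x\<in>{r}. Poly_Mapping.lookup (W x) (E r))"
    proof (rule sum.mono_neutral_right)
      show "\<forall>x\<in>?P - {r}. Poly_Mapping.lookup (W x) (E r) = 0"
      proof
        fix x assume x: "x \<in> ?P - {r}"
        show "Poly_Mapping.lookup (W x) (E r) = 0"
          using x W0[of x] W1[of x] E_inj[of x r] r by (cases "supp x") (auto simp: lookup_single when_def)
      qed
    qed (use r in \<open>auto simp: finite_permutations\<close>)
    also have "\<dots> \<noteq> 0"
      using W1[OF r] by auto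
    finally have "E r = a \<or> E r = b"
      using ab by (auto simp: monomial_def lookup_add lookup_minus lookup_single when_def split: if_splits)
    then show ?thesis
      using E_inj[OF r p(1,2)] E_inj[OF r q(1,2)] p(3) q(3) by auto
  qed
  \<comment> \<open>For \<open>k = 0\<close> both exponents would be empty sums, against
    \<open>a \<noteq> b\<close>.\<close>
  have k: "0 < k"
    using ab p q by (cases k) (auto simp: E_def)
  define p' where "p' = Hilbert_Choice.inv p"
  define f where "f = q \<circ> p'"
  have p': "p' permutes {..<k}"
    unfolding p'_def using p(1) by (rule permutes_inv)
  have f: "f permutes {..<k}"
    unfolding f_def using p' q(1) by (rule permutes_compose)
  have fp: "f (p j) = q j" for j
    using p(1) by (simp add: f_def p'_def permutes_inverses)
  have pinv: "p (p' i) = i" for i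
    using p(1) by (simp add: p'_def permutes_inverses)
  have inv_less: "p' i < k" if "i < k" for i
    using permutes_in_image[OF p', of i] that by simp
  have qinv: "q (p' i) = f i" for i
    by (simp add: f_def)
  have perm_f: "permutation f"
    using f by (auto simp: permutation_permutes)
  have orbit: "{..<k} \<subseteq> orbit f 0"
  proof -
    let ?S = "{..<k} - orbit f 0"
    \<comment> \<open>If the orbit of \<open>0\<close> missed some row, following \<open>q\<close>
      outside the orbit and \<open>p\<close> inside would give a third nonzero term.\<close>
    define r where "r = perm_restrict f ?S \<circ> p"
    have "perm_restrict f ?S permutes ?S"
      using perm_restrict_diff_cyclic[OF f cyclic_on_orbit[OF f]] by simp
    then have "r permutes {..<k}"
      unfolding r_def using p(1) by (intro permutes_compose) (auto intro: permutes_subset)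
    moreover have rj: "r j = (if p j \<in> ?S then q j else p j)" for j
      by (simp add: r_def perm_restrict_def fp)
    then have "supp r"
      using p(2) q(2) by (simp add: supp_def)
    ultimately have "r = p \<or> r = q"
      by (rule only)
    moreover have "r (p' 0) \<noteq> q (p' 0)"
      using rj[of "p' 0"] pq[OF inv_less[OF k]] pinv permutation_self_in_orbit[OF perm_f] by auto
    ultimately have "r = p" by auto
    show ?thesis
    proof
      fix i assume "i \<in> {..<k}"
      then show "i \<in> orbit f 0"
        using rj[of "p' i"] pq[OF inv_less, of i] pinv[of i] \<open>r = p\<close> by (auto split: if_splits)
    qed
  qed
  define u where "u i = (f ^^ i) 0" for i
  define c where "c i = p' (u i)" for i
  have bij_u: "bij_betw u {..<k} {..<k}" and uk: "u k = 0"
    using cycle_of_permutes[OF f k orbit] by (auto simp: u_def[abs_def])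
  have bij_c: "bij_betw c {..<k} {..<k}"
    using bij_betw_trans[OF bij_u permutes_imp_bij[OF p']]
    by (simp add: c_def[abs_def] comp_def)
  \<comment> \<open>The reduction modulo \<open>k\<close> matters only for the last index, where
    \<open>u k = 0\<close> closes the cycle.\<close>
  have u_next: "u (Suc i mod k) = q (c i)" if "i < k" for i
  proof -
    have "u (Suc i mod k) = u (Suc i)"
      using that uk by (cases "Suc i = k") (auto simp: u_def)
    then show ?thesis
      by (simp add: c_def qinv u_def)
  qed
  have u_p: "u i = p (c i)" for i
    by (simp add: c_def pinv)
  have c_less: "c i < k" if "i < k" for i
    using bij_c that by (auto simp: bij_betw_def)
  have inj_c: "inj_on c {..<k}" and img_c: "c ` {..<k} = {..<k}"
    using bij_c by (auto simp: bij_betw_def)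
  show ?thesis
  proof (rule that[OF _ bij_u bij_c])
    show "2 \<le> k"
    proof (rule ccontr)
      assume "\<not> 2 \<le> k"
      with k have "k = 1" by simp
      then show False
        using pq[of 0] less[of 0] by simp
    qed
    show "M $$ (u i, c i) \<noteq> 0" if "i < k" for i
      using p(2) c_less[OF that] by (simp add: supp_def u_p)
    show "M $$ (u (Suc i mod k), c i) \<noteq> 0" if "i < k" for i
      using q(2) c_less[OF that] u_next[OF that] by (simp add: supp_def)
    show "inj_on (\<lambda>i. e (u i) (c i)) {..<k}"
      using comp_inj_on[OF inj_c, of "\<lambda>j. e (p j) j"] injp img_c by (simp add: u_p comp_def)
    have "inj_on (\<lambda>i. e (q (c i)) (c i)) {..<k}"
      using comp_inj_on[OF inj_c, of "\<lambda>j. e (q j) j"] injq img_c by (simp add: comp_def)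
    then show "inj_on (\<lambda>i. e (u (Suc i mod k)) (c i)) {..<k}"
      by (rule inj_on_cong[THEN iffD1, rotated]) (simp add: u_next)
    show "e (u i) (c i) \<noteq> e (u (Suc j mod k)) (c j)" if "i < k" "j < k" for i j
      using disj[of "c i" "c j"] c_less that u_next[OF that(2)] by (simp add: u_p)
  qed
qed

section \<open>Indecomposable even circuits\<close>

text \<open>The vertex list repeats its first entry at the end, so successors may be taken modulo
  the length, a form compatible with rotation.\<close>

lemma even_circuit_cyclic:
  "even_circuit fs vs as \<longleftrightarrow> as \<noteq> [] \<and> distinct as \<and> even (length as) \<and>
     length vs = Suc (length as) \<and> hd vs = last vs \<and>
     (\<forall>t < length as. as ! t < length fs \<and> fs ! (as ! t) = {vs ! t, vs ! (Suc t mod length as)})"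
proof -
  have "vs ! (Suc t mod length as) = vs ! Suc t"
    if "length vs = Suc (length as)" "hd vs = last vs" "t < length as" for t
  proof (cases "Suc t = length as")
    case True
    moreover have "vs \<noteq> []"
      using that(1) by auto
    ultimately show ?thesis
      using that by (simp add: hd_conv_nth last_conv_nth)
  qed (use that in simp)
  then show ?thesis
    unfolding even_circuit_def circuit_def walk_def by auto
qed

text \<open>After a rotation by \<open>i\<close>, the stretch between two occurrences of a vertex is
  itself closed. The index modulo the length admits a stretch reaching the end of the rotated
  list.\<close>

lemma even_circuit_segment:
  assumes C: "even_circuit fs vs as"
    and w: "w = rotate i (butlast vs)" and e: "e = rotate i as"
    and l: "0 < l" "even l" "a + l \<le> length as" "w ! a = w ! ((a + l) mod length as)"
  shows "even_circuit fs (take l (drop a w) @ [w ! a]) (take l (drop a e))"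
proof -
  let ?L = "length as"
  have L: "0 < ?L" and len: "length vs = Suc ?L" and d: "distinct as"
    and edge: "\<And>t. t < ?L \<Longrightarrow> as ! t < length fs \<and> fs ! (as ! t) = {vs ! t, vs ! (Suc t mod ?L)}"
    using C unfolding even_circuit_cyclic by auto
  have lens: "length w = ?L" "length e = ?L"
    by (auto simp: w e len)
  have wn: "w ! t = vs ! ((i + t) mod ?L)" and en: "e ! t = as ! ((i + t) mod ?L)" if "t < ?L" for t
    using that L len by (auto simp: w e nth_rotate nth_butlast add.commute)
  have edge': "e ! t < length fs \<and> fs ! (e ! t) = {w ! t, w ! (Suc t mod ?L)}" if t: "t < ?L" for t
  proof -
    have "w ! (Suc t mod ?L) = vs ! (Suc ((i + t) mod ?L) mod ?L)"
      using L by (simp add: wn mod_simps)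
    then show ?thesis
      using edge[of "(i + t) mod ?L"] L t by (simp add: wn en)
  qed
  have "e ! (a + t) < length fs \<and> fs ! (e ! (a + t)) =
      {(take l (drop a w) @ [w ! a]) ! t, (take l (drop a w) @ [w ! a]) ! (Suc t mod l)}" if t: "t < l" for t
  proof (cases "Suc t = l")
    \<comment> \<open>The last edge of the stretch ends at the second occurrence of
      \<open>w ! a\<close>.\<close>
    case True
    then have "w ! (Suc (a + t) mod ?L) = w ! a"
      using l(4) by (metis add_Suc_right)
    then show ?thesis
      using edge'[of "a + t"] t l lens True by (simp add: nth_append)
  next
    case False
    with t l have "Suc (a + t) < ?L" "Suc t < l"
      by auto
    then show ?thesis
      using edge'[of "a + t"] t l lens by (simp add: nth_append)
  qed
  then show ?thesis
    unfolding even_circuit_cyclic using l d lens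
    by (auto simp: e hd_append hd_drop_conv_nth distinct_take distinct_drop)
qed

text \<open>Cutting at a repeated vertex leaves two even pieces exactly when the positions have
  equal parity. The final position is left out: it always repeats position \<open>0\<close> and
  gives no splitting.\<close>

lemma indecomposable_even_circuit_iff:
  assumes C: "even_circuit fs vs as"
  shows "indecomposable_even_circuit fs vs as \<longleftrightarrow>
    (\<forall>i j. i < j \<and> j < length as \<and> even (j - i) \<longrightarrow> vs ! i \<noteq> vs ! j)"
proof -
  let ?L = "length as"
  have L: "0 < ?L" "even ?L" and len: "length vs = Suc ?L"
    using C unfolding even_circuit_cyclic by auto
  have "union_of_smaller_even_circuits fs vs as"
    if ij: "i < j" "j < ?L" "even (j - i)" "vs ! i = vs ! j" for i j
  proof -
    define l where "l = j - i"
    \<comment> \<open>The rotation moves the two occurrences to the positions \<open>0\<close> and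
      \<open>l\<close>.\<close>
    define w where "w = rotate i (butlast vs)"
    define e where "e = rotate i as"
    have l: "0 < l" "l < ?L" "even l"
      using ij by (auto simp: l_def)
    have lens: "length w = ?L" "length e = ?L"
      by (auto simp: w_def e_def len)
    have wl: "w ! 0 = w ! l"
      using ij L len by (auto simp: w_def l_def nth_rotate nth_butlast)
    have "even_circuit fs (take l (drop 0 w) @ [w ! 0]) (take l (drop 0 e))"
      by (rule even_circuit_segment[OF C w_def e_def]) (use l wl in auto)
    \<comment> \<open>This piece ends at position \<open>?L\<close>, which is \<open>0\<close>
      modulo \<open>?L\<close> and thus the repeated vertex again.\<close>
    moreover have "even_circuit fs (take (?L - l) (drop l w) @ [w ! l]) (take (?L - l) (drop l e))"
      by (rule even_circuit_segment[OF C w_def e_def]) (use l L wl in auto)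
    moreover have "set (take l e) \<inter> set (drop l e) = {}"
      using C by (intro set_take_disj_set_drop_if_distinct) (auto simp: e_def even_circuit_cyclic)
    moreover have "hd (take l w @ [w ! 0]) = hd (drop l w @ [w ! l])"
      using l lens wl by (simp add: hd_append hd_drop_conv_nth hd_conv_nth)
    moreover have "rotate i as = take l e @ drop l e"
      by (simp add: e_def)
    moreover have "rotate i (butlast vs) = butlast (take l w @ [w ! 0]) @ butlast (drop l w @ [w ! l])"
      by (simp add: w_def)
    moreover have "length (take l e) < ?L" "length (drop l e) < ?L"
      using l lens by auto
    moreover have "take (?L - l) (drop l w) = drop l w" "take (?L - l) (drop l e) = drop l e"
      using lens by auto
    ultimately show ?thesis
      unfolding union_of_smaller_even_circuits_def drop_0 by metis
  qed
  moreover have "\<exists>i j. i < j \<and> j < ?L \<and> even (j - i) \<and> vs ! i = vs ! j"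
    if union: "union_of_smaller_even_circuits fs vs as"
  proof -
    obtain s vs1 as1 vs2 as2 where C1: "even_circuit fs vs1 as1" and C2: "even_circuit fs vs2 as2"
      and small: "length as1 < ?L" and hd: "hd vs1 = hd vs2"
      and rot: "rotate s (butlast vs) = butlast vs1 @ butlast vs2"
      using union by (auto simp: union_of_smaller_even_circuits_def)
    let ?l = "length as1"
    have l: "0 < ?l" "even ?l" and len1: "length (butlast vs1) = ?l"
      using C1 unfolding even_circuit_cyclic by auto
    have len2: "length (butlast vs2) = length as2" "0 < length as2"
      using C2 unfolding even_circuit_cyclic by auto
    have hd_butlast: "butlast xs ! 0 = hd xs" if "butlast xs \<noteq> []" for xs :: "nat list"
      using that by (cases xs) auto
    have nz: "butlast vs1 \<noteq> []" "butlast vs2 \<noteq> []"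
      unfolding length_greater_0_conv[symmetric] using l len1 len2 by simp_all
    have vs_nth: "rotate s (butlast vs) ! t = vs ! ((s + t) mod ?L)" if "t < ?L" for t
      using that L len by (simp add: nth_rotate nth_butlast)
    have "(butlast vs1 @ butlast vs2) ! 0 = hd vs1"
      using nz(1) hd_butlast[OF nz(1)] by (cases "butlast vs1") auto
    then have "vs ! ((s + 0) mod ?L) = hd vs1"
      using vs_nth[of 0] L by (simp add: rot)
    moreover have "vs ! ((s + ?l) mod ?L) = hd vs2"
      using vs_nth[of ?l] small nth_append_length_plus[of "butlast vs1" "butlast vs2" 0] len1
        hd_butlast[OF nz(2)] by (simp add: rot)
    ultimately have eq: "vs ! (s mod ?L) = vs ! ((s + ?l) mod ?L)"
      using hd by simp
    \<comment> \<open>Parity survives the reduction because \<open>?L\<close> is even.\<close>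
    have par: "even (s mod ?L) \<longleftrightarrow> even ((s + ?l) mod ?L)"
      using L l by (simp add: dvd_mod_iff)
    have neq: "s mod ?L \<noteq> (s + ?l) mod ?L"
    proof
      assume "s mod ?L = (s + ?l) mod ?L"
      then have "?L dvd ?l"
        by (metis add_diff_cancel_left' le_add1 mod_eq_dvd_iff_nat)
      with l small show False
        by (auto dest: dvd_imp_le)
    qed
    have less: "s mod ?L < ?L" "(s + ?l) mod ?L < ?L"
      using L by auto
    show ?thesis
    proof (cases "s mod ?L < (s + ?l) mod ?L")
      case True
      with eq par less show ?thesis
        by (metis even_diff_nat even_add)
    next
      case False
      with neq have "(s + ?l) mod ?L < s mod ?L"
        by simp
      with eq par less show ?thesis
        by (metis even_diff_nat even_add)
    qed
  qed
  ultimately show ?thesis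
    using C unfolding indecomposable_even_circuit_def by blast
qed

section \<open>Monomials of a circuit binomial\<close>

lemma pvar_nonzero [simp]: "(pvar i :: 'a::comm_ring_1 mpoly) \<noteq> 0"
  by (metis lookup_pvar_single lookup_zero zero_neq_one)

lemma prod_pvar:
  "finite S \<Longrightarrow> (\<Prod>j\<in>S. pvar (g j)) = (monomial (\<Sum>j\<in>S. Poly_Mapping.single (g j) 1) :: 'a::comm_ring_1 mpoly)"
  by (induction S rule: finite_induct) (simp_all add: pvar_def monomial_def mult_single flip: single_one)

text \<open>The two monomials collect the edges at odd and at even positions, and all of these are
  distinct.\<close>

lemma squarefree_coprime_circuit_binomial:
  assumes "distinct as" "even (length as)" "as \<noteq> []"
    and d: "d = circuit_binomial as \<or> d = - circuit_binomial as"
  shows "squarefree_coprime_binomial (d :: 'k::field mpoly)"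
proof -
  let ?m = "length as div 2"
  define a where "a = (\<Sum>i<?m. Poly_Mapping.single (as ! (2 * i + 1)) (1::nat))"
  define b where "b = (\<Sum>i<?m. Poly_Mapping.single (as ! (2 * i)) (1::nat))"
  have m: "0 < ?m" "length as = 2 * ?m"
    using assms(2,3) by (auto simp flip: length_greater_0_conv elim!: evenE)
  have eq: "as ! s = as ! t \<longleftrightarrow> s = t" if "s < 2 * ?m" "t < 2 * ?m" for s t
    using that m(2) assms(1) by (simp add: nth_eq_iff_index_eq)
  have cb: "(circuit_binomial as :: 'k mpoly) = monomial a - monomial b"
    by (simp add: circuit_binomial_def a_def b_def prod_pvar)
  have "inj_on (\<lambda>i. as ! (2 * i + 1)) {..<?m}" "inj_on (\<lambda>i. as ! (2 * i)) {..<?m}"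
    using eq by (auto simp: inj_on_def)
  then have sq: "squarefree_exp a" "squarefree_exp b"
    by (simp_all add: a_def b_def squarefree_sum_single)
  have keys: "Poly_Mapping.keys a = (\<lambda>i. as ! (2 * i + 1)) ` {..<?m}"
    "Poly_Mapping.keys b = (\<lambda>i. as ! (2 * i)) ` {..<?m}"
    by (simp_all add: a_def b_def keys_sum_single)
  have ne: "as ! (2 * i + 1) \<noteq> as ! (2 * j)" if "i < ?m" "j < ?m" for i j
  proof -
    have "2 * i + 1 \<noteq> 2 * j"
      by presburger
    then show ?thesis
      using eq[of "2 * i + 1" "2 * j"] that by auto
  qed
  have cop: "Poly_Mapping.keys a \<inter> Poly_Mapping.keys b = {}"
    unfolding keys using ne by auto
  have "a \<noteq> b"
    using cop keys m(1) by auto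
  \<comment> \<open>A negative sign is absorbed by exchanging the two monomials.\<close>
  then have "is_binomial_in d a b \<or> is_binomial_in d b a"
    using d by (auto simp: cb is_binomial_in_def)
  then show ?thesis
    using sq cop unfolding squarefree_coprime_binomial_def coprime_exp_def by blast
qed

section \<open>Minors and circuits\<close>

locale taylor_reduced_dual =
  fixes n :: nat and fs :: "nat set list" and B :: "'k::field mpoly mpoly mat" and A :: "'k mpoly mat"
  assumes graph: "simple_graph n fs"
    and dual: "jacobian_dual n (taylor_matrix fs) B"
    and A_def: "A = reduced_jacobian_dual B"
begin

lemma dims: "dim_row A = n" "dim_col A = length (edge_pairs fs)"
  using dual by (auto simp: A_def reduced_jacobian_dual_def jacobian_dual_def taylor_matrix_def)

lemma entry:
  assumes "x < n" "c < dim_col A" "edge_pairs fs ! c = (j, k)"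
  shows "A $$ (x, c) =
    (if fs ! j - fs ! k = {x} then pvar k else if fs ! k - fs ! j = {x} then - pvar j else 0)"
  using assms reduced_jacobian_dual_taylor[OF graph dual] by (simp add: A_def dims[unfolded A_def])

section \<open>Nonzero columns as paths of length 2\<close>

lemma edge: "a < length fs \<Longrightarrow> fs ! a \<subseteq> {..<n} \<and> card (fs ! a) = 2"
  using graph by (simp add: simple_graph_def)

lemma edge_inj: "a < length fs \<Longrightarrow> b < length fs \<Longrightarrow> fs ! a = fs ! b \<Longrightarrow> a = b"
  using graph by (simp add: simple_graph_def nth_eq_iff_index_eq)

text \<open>Stands for the path from \<open>x\<close> along \<open>a\<close> to \<open>v\<close> and
  along \<open>b\<close> to \<open>y\<close>. The edges appear crosswise: row \<open>x\<close>
  carries \<open>b\<close>. The common sign \<open>s\<close> leaves open whether the direction of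
  the path agrees with the numbering of the edges, so the notion is symmetric under
  reversal.\<close>

definition path_column :: "nat \<Rightarrow> nat \<Rightarrow> nat \<Rightarrow> nat \<Rightarrow> nat \<Rightarrow> nat \<Rightarrow> bool" where
  "path_column c x a v b y \<longleftrightarrow> a < length fs \<and> b < length fs \<and>
     fs ! a = {x, v} \<and> fs ! b = {v, y} \<and> middle_vertex fs c = v \<and>
     (\<exists>s. (s = 1 \<or> s = - 1) \<and> A $$ (x, c) = s * pvar b \<and> A $$ (y, c) = - (s * pvar a)) \<and>
     (\<forall>z<n. z \<noteq> x \<longrightarrow> z \<noteq> y \<longrightarrow> A $$ (z, c) = 0)"

lemma path_column_commute: "path_column c x a v b y \<Longrightarrow> path_column c y b v a x"
  unfolding path_column_def by (auto simp: insert_commute)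

lemma path_column_ordered:
  assumes c: "c < dim_col A" "edge_pairs fs ! c = (a, b)"
    and xy: "x \<noteq> y" "x \<noteq> v" "y \<noteq> v" and a: "fs ! a = {x, v}" and b: "fs ! b = {v, y}"
  shows "path_column c x a v b y"
proof -
  have ab: "a < length fs" "b < length fs"
    using nth_mem[of c "edge_pairs fs"] c by (auto simp: dims set_edge_pairs)
  have diff: "fs ! a - fs ! b = {x}" "fs ! b - fs ! a = {y}" and inter: "fs ! a \<inter> fs ! b = {v}"
    using xy by (auto simp: a b)
  have less: "x < n" "y < n"
    using edge[OF ab(1)] edge[OF ab(2)] by (auto simp: a b)
  have "middle_vertex fs c = v"
    by (simp add: middle_vertex_def c inter)
  moreover have "A $$ (x, c) = 1 * pvar b" "A $$ (y, c) = - (1 * pvar a)"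
    using less xy by (auto simp: entry[OF _ c] diff)
  moreover have "A $$ (z, c) = 0" if "z < n" "z \<noteq> x" "z \<noteq> y" for z
    using that by (simp add: entry[OF _ c] diff)
  ultimately show ?thesis
    unfolding path_column_def using ab a b by blast
qed

text \<open>Only one order of the two edges occurs in \<open>edge_pairs\<close>; the other case is
  the reversed path.\<close>

lemma column_of_path:
  assumes ab: "a < length fs" "b < length fs"
    and a: "fs ! a = {x, v}" and b: "fs ! b = {v, y}" and xy: "x \<noteq> y"
  shows "\<exists>c<dim_col A. path_column c x a v b y"
proof -
  have ne: "x \<noteq> v" "y \<noteq> v"
    using edge[OF ab(1)] edge[OF ab(2)] by (auto simp: a b)
  have "a \<noteq> b"
    using xy a b by (auto simp: doubleton_eq_iff)
  then have "(a, b) \<in> set (edge_pairs fs) \<or> (b, a) \<in> set (edge_pairs fs)"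
    using ab by (auto simp: set_edge_pairs)
  then obtain c where c: "c < dim_col A" "edge_pairs fs ! c = (a, b) \<or> edge_pairs fs ! c = (b, a)"
    by (metis dims(2) in_set_conv_nth)
  from c(2) have "path_column c x a v b y"
  proof
    assume "edge_pairs fs ! c = (a, b)"
    then show ?thesis
      using c(1) xy ne a b by (intro path_column_ordered)
  next
    assume "edge_pairs fs ! c = (b, a)"
    then have "path_column c y b v a x"
      using c(1) xy ne a b by (intro path_column_ordered) (auto simp: insert_commute)
    then show ?thesis
      by (rule path_column_commute)
  qed
  then show ?thesis
    using c(1) by blast
qed

text \<open>Only meaningful for a nonzero entry, which is up to sign the variable of this edge.\<close>

definition entry_edge :: "nat \<Rightarrow> nat \<Rightarrow> nat" where
  "entry_edge x c = (let (j, k) = edge_pairs fs ! c in if fs ! j - fs ! k = {x} then k else j)"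

lemma entry_cases:
  assumes "x < n" "c < dim_col A" "A $$ (x, c) \<noteq> 0"
  shows "A $$ (x, c) = pvar (entry_edge x c) \<or> A $$ (x, c) = - pvar (entry_edge x c)"
proof -
  obtain j k where jk: "edge_pairs fs ! c = (j, k)"
    by fastforce
  show ?thesis
    using assms(3) entry[OF assms(1,2) jk]
    by (cases "fs ! j - fs ! k = {x}"; cases "fs ! k - fs ! j = {x}") (simp_all add: entry_edge_def jk)
qed

text \<open>Two nonzero entries force the differences of the two edges to be \<open>{x}\<close> and
  \<open>{y}\<close>; as edges have two vertices, exactly one is shared.\<close>

lemma path_of_column:
  assumes c: "c < dim_col A" and x: "x < n" "A $$ (x, c) \<noteq> 0" and y: "y < n" "A $$ (y, c) \<noteq> 0"
    and xy: "x \<noteq> y"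
  shows "path_column c x (entry_edge y c) (middle_vertex fs c) (entry_edge x c) y"
proof -
  obtain j k where jk: "edge_pairs fs ! c = (j, k)"
    by fastforce
  have less: "j < length fs" "k < length fs"
    using nth_mem[of c "edge_pairs fs"] c jk by (auto simp: dims set_edge_pairs)
  have main: "path_column c x j (middle_vertex fs c) k y \<and> entry_edge y c = j \<and> entry_edge x c = k"
    if diff: "fs ! j - fs ! k = {x}" "fs ! k - fs ! j = {y}" and xy: "x \<noteq> y" for x y
  proof -
    have "card (fs ! j \<inter> fs ! k) = 1"
    proof -
      have "finite (fs ! j)"
        using edge[OF less(1)] by (metis card.infinite zero_neq_numeral)
      then show ?thesis
        using card_Int_Diff[of "fs ! j" "fs ! k"] edge[OF less(1)] diff by simp
    qed
    then obtain v where v: "fs ! j \<inter> fs ! k = {v}"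
      by (auto simp: card_1_singleton_iff One_nat_def)
    then have "fs ! j = {x, v}" "fs ! k = {v, y}" "x \<noteq> v" "y \<noteq> v"
      using diff by auto
    moreover have "middle_vertex fs c = v"
      by (simp add: middle_vertex_def jk v)
    moreover have "entry_edge y c = j" "entry_edge x c = k"
      using diff xy by (auto simp: entry_edge_def jk)
    ultimately show ?thesis
      using path_column_ordered[OF c jk xy] by simp
  qed
  have "fs ! j - fs ! k = {x} \<and> fs ! k - fs ! j = {y} \<or> fs ! j - fs ! k = {y} \<and> fs ! k - fs ! j = {x}"
    using x y xy by (auto simp: entry[OF _ c jk] split: if_splits)
  then show ?thesis
    using main[of x y] main[of y x] xy path_column_commute by metis
qed

text \<open>Serves both directions: columns of consecutive paths along a circuit form the cyclic
  bidiagonal pattern on the rows \<open>U i\<close>, with the centers \<open>V i\<close>.\<close>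

lemma det_submatrix_path_columns:
  assumes m: "2 \<le> m" "length as = 2 * m"
    and U: "inj_on U {..<m}" and V: "inj_on V {..<m}"
    and c: "\<And>i. i < m \<Longrightarrow> c i < dim_col A"
    and path: "\<And>i. i < m \<Longrightarrow> path_column (c i) (U i) (as ! (2 * i)) (V i) (as ! (2 * i + 1)) (U (Suc i mod m))"
    and I: "I = U ` {..<m}" and J: "J = c ` {..<m}"
  shows "det (submatrix A I J) = circuit_binomial as \<or> det (submatrix A I J) = - circuit_binomial as"
    and "square_submatrix A I J (submatrix A I J)"
    and "pairwise (center_distinct fs A) J"
proof -
  have mid: "middle_vertex fs (c i) = V i" if "i < m" for i
    using path[OF that] by (simp add: path_column_def)
  \<comment> \<open>Columns with different middle vertices are different.\<close>
  have injc: "inj_on c {..<m}"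
    using V mid by (metis (mono_tags, lifting) inj_on_def lessThan_iff)
  have Un: "U i < n" if "i < m" for i
    using path[OF that] edge[of "as ! (2 * i)"] by (auto simp: path_column_def)
  have "\<exists>s. (s = 1 \<or> s = - 1) \<and> A $$ (U i, c i) = s * pvar (as ! (2 * i + 1)) \<and>
      A $$ (U (Suc i mod m), c i) = - (s * pvar (as ! (2 * i)))" if "i < m" for i
    using path[OF that] by (simp add: path_column_def)
  then obtain s where s: "\<And>i. i < m \<Longrightarrow> s i = 1 \<or> s i = - 1"
    "\<And>i. i < m \<Longrightarrow> A $$ (U i, c i) = s i * pvar (as ! (2 * i + 1))"
    "\<And>i. i < m \<Longrightarrow> A $$ (U (Suc i mod m), c i) = - (s i * pvar (as ! (2 * i)))"
    by metis
  have sub: "U ` {..<m} \<subseteq> {..<dim_row A}" "c ` {..<m} \<subseteq> {..<dim_col A}"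
    using Un c by (auto simp: dims)
  show "det (submatrix A I J) = circuit_binomial as \<or> det (submatrix A I J) = - circuit_binomial as"
    unfolding I J
  proof (rule det_submatrix_cycle[OF m(1) U sub(1) injc sub(2) s])
    show "A $$ (x, c i) = 0" if "i < m" "x < dim_row A" "x \<noteq> U i" "x \<noteq> U (Suc i mod m)" for i x
      using path[OF that(1)] that(2-) by (simp add: path_column_def dims)
    show "circuit_binomial as = (\<Prod>i<m. pvar (as ! (2 * i + 1))) - (\<Prod>i<m. pvar (as ! (2 * i)))"
      by (simp add: circuit_binomial_def m)
  qed
  show "square_submatrix A I J (submatrix A I J)"
    using sub U injc by (simp add: square_submatrix_def I J card_image)
  have nz: "col A (c i) \<noteq> 0\<^sub>v (dim_row A)" if i: "i < m" for i
  proof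
    assume "col A (c i) = 0\<^sub>v (dim_row A)"
    then have "col A (c i) $ U i = 0"
      using Un[OF i] by (simp add: dims)
    then show False
      using s(1,2)[OF i] Un[OF i] c[OF i] by (auto simp: dims)
  qed
  show "pairwise (center_distinct fs A) J"
    using nz mid V unfolding J pairwise_def center_distinct_def by (auto dest: inj_onD)
qed

text \<open>Vertices at even positions become rows, those at odd positions centers;
  indecomposability makes both families injective.\<close>

lemma minor_of_circuit:
  assumes C: "indecomposable_even_circuit fs vs as"
  shows "\<exists>I J M. square_submatrix A I J M \<and> squarefree_coprime_binomial (det M) \<and>
    pairwise (center_distinct fs A) J \<and> (det M = circuit_binomial as \<or> det M = - circuit_binomial as)"
proof -
  have E: "even_circuit fs vs as"
    using C by (simp add: indecomposable_even_circuit_def)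
  have as: "as \<noteq> []" "distinct as" "even (length as)"
    and edge_as: "\<And>t. t < length as \<Longrightarrow> as ! t < length fs \<and> fs ! (as ! t) = {vs ! t, vs ! (Suc t mod length as)}"
    using E unfolding even_circuit_cyclic by auto
  obtain m where m: "length as = 2 * m"
    using as(3) by (rule evenE)
  define U where "U i = vs ! (2 * i)" for i
  define V where "V i = vs ! (2 * i + 1)" for i
  have dist: "vs ! i \<noteq> vs ! j" if "i < j" "j < 2 * m" "even (j - i)" for i j
    using C that unfolding indecomposable_even_circuit_iff[OF E] m by blast
  have U: "inj_on U {..<m}" and V: "inj_on V {..<m}"
    by (rule linorder_inj_onI'; simp add: U_def V_def dist)+
  have e0: "as ! (2 * i) < length fs" "fs ! (as ! (2 * i)) = {U i, V i}"
    and e1: "as ! (2 * i + 1) < length fs" "fs ! (as ! (2 * i + 1)) = {V i, U (Suc i mod m)}"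
    if i: "i < m" for i
  proof -
    show "as ! (2 * i) < length fs" "fs ! (as ! (2 * i)) = {U i, V i}"
      using edge_as[of "2 * i"] i by (simp_all add: m U_def V_def flip: Suc_eq_plus1)
    \<comment> \<open>The path with the last index \<open>m - 1\<close> thus ends at
      \<open>U 0\<close>.\<close>
    have "Suc (2 * i + 1) mod (2 * m) = 2 * (Suc i mod m)"
      by (simp add: mult_mod_right)
    then show "as ! (2 * i + 1) < length fs" "fs ! (as ! (2 * i + 1)) = {V i, U (Suc i mod m)}"
      using edge_as[of "2 * i + 1"] i by (simp_all add: m U_def V_def)
  qed
  \<comment> \<open>A circuit of length 2 would use two edges with the same ends, hence one edge
    twice.\<close>
  have m2: "2 \<le> m"
  proof (rule ccontr)
    assume "\<not> 2 \<le> m"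
    then have m1: "m = 1"
      using as(1) m by (cases m) auto
    then have "as ! 0 = as ! 1"
      using e0[of 0] e1[of 0] by (intro edge_inj) (auto simp: insert_commute)
    then show False
      using as(2) m m1 by (simp add: nth_eq_iff_index_eq)
  qed
  have "U i \<noteq> U (Suc i mod m)" if "i < m" for i
    using inj_onD[OF U, of i "Suc i mod m"] that m2 by (cases "Suc i = m") auto
  then have "\<exists>c<dim_col A. path_column c (U i) (as ! (2 * i)) (V i) (as ! (2 * i + 1)) (U (Suc i mod m))"
    if "i < m" for i
    using that e0[OF that] e1[OF that] by (intro column_of_path)
  then obtain c where c: "\<And>i. i < m \<Longrightarrow> c i < dim_col A"
    "\<And>i. i < m \<Longrightarrow> path_column (c i) (U i) (as ! (2 * i)) (V i) (as ! (2 * i + 1)) (U (Suc i mod m))"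
    by metis
  note D = det_submatrix_path_columns[OF m2 m U V c refl refl]
  show ?thesis
    using D squarefree_coprime_circuit_binomial[OF as(2,3,1) D(1)] by blast
qed

text \<open>The cycle hidden in the determinant is read back in the graph. Square-free coprime
  monomials make the edges distinct; distinct rows and centers make the circuit
  indecomposable.\<close>

lemma circuit_of_minor:
  assumes M: "square_submatrix A I J M" and det: "squarefree_coprime_binomial (det M)"
    and centers: "pairwise (center_distinct fs A) J"
  shows "\<exists>vs as. indecomposable_even_circuit fs vs as \<and>
    (det M = circuit_binomial as \<or> det M = - circuit_binomial as)"
proof -
  have I: "I \<subseteq> {..<n}" and J: "J \<subseteq> {..<dim_col A}" and card: "card J = card I"
    and M_eq: "M = submatrix A I J"
    using M by (auto simp: square_submatrix_def dims)
  define k where "k = card I"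
  have mat: "M = mat k k (\<lambda>(i, j). A $$ (pick I i, pick J j))"
    unfolding M_eq k_def using I J card by (subst submatrix_subset) (auto simp: dims)
  have bijI: "bij_betw (pick I) {..<k} I" and bijJ: "bij_betw (pick J) {..<k} J"
    using bij_betw_pick[of I] bij_betw_pick[of J] I J finite_subset by (auto simp: k_def card)
  have pickI: "pick I i < n" and pickJ: "pick J i < dim_col A" if "i < k" for i
    using bijI bijJ I J that by (auto simp: bij_betw_def)
  have pickI_eq: "pick I i = pick I j \<longleftrightarrow> i = j" if "i < k" "j < k" for i j
    using bijI that by (auto simp: bij_betw_def inj_on_eq_iff)
  have "M \<in> carrier_mat k k"
    by (simp add: mat)
  then obtain u c where k: "2 \<le> k" and u: "bij_betw u {..<k} {..<k}" and c: "bij_betw c {..<k} {..<k}"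
    and nz: "\<And>i. i < k \<Longrightarrow> M $$ (u i, c i) \<noteq> 0" "\<And>i. i < k \<Longrightarrow> M $$ (u (Suc i mod k), c i) \<noteq> 0"
    and inj: "inj_on (\<lambda>i. entry_edge (pick I (u i)) (pick J (c i))) {..<k}"
      "inj_on (\<lambda>i. entry_edge (pick I (u (Suc i mod k))) (pick J (c i))) {..<k}"
    and disj: "\<And>i j. i < k \<Longrightarrow> j < k \<Longrightarrow>
      entry_edge (pick I (u i)) (pick J (c i)) \<noteq> entry_edge (pick I (u (Suc j mod k))) (pick J (c j))"
  proof (rule cycle_of_binomial_det[where e = "\<lambda>i j. entry_edge (pick I i) (pick J j)"])
    show "M $$ (i, j) = pvar (entry_edge (pick I i) (pick J j)) \<or>
        M $$ (i, j) = - pvar (entry_edge (pick I i) (pick J j))"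
      if "i < k" "j < k" "M $$ (i, j) \<noteq> 0" for i j
      using that entry_cases[OF pickI pickJ] by (simp add: mat)
    \<comment> \<open>Two nonzero entries make the column a \<open>path_column\<close>, which
      vanishes in all other rows.\<close>
    show "z = x \<or> z = y" if "x < k" "y < k" "z < k" "j < k"
      "M $$ (x, j) \<noteq> 0" "M $$ (y, j) \<noteq> 0" "M $$ (z, j) \<noteq> 0" "x \<noteq> y" for x y z j
      using that path_of_column[OF pickJ[of j] pickI[of x] _ pickI[of y]] pickI[of z]
      by (auto simp: mat path_column_def pickI_eq)
    show "squarefree_coprime_binomial (det M)"
      by (rule det)
  qed (rule that; assumption)
  define U where "U i = pick I (u i)" for i
  define C where "C i = pick J (c i)" for i
  define V where "V i = middle_vertex fs (C i)" for i
  \<comment> \<open>Crosswise again: the edge leaving \<open>U i\<close> is found in the row of the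
    next vertex.\<close>
  define a where "a i = entry_edge (U (Suc i mod k)) (C i)" for i
  define b where "b i = entry_edge (U i) (C i)" for i
  have next_less: "Suc i mod k < k" for i
    using k by simp
  have u_less: "u i < k" and c_less: "c i < k" if "i < k" for i
    using u c that by (auto simp: bij_betw_def)
  have "bij_betw U {..<k} I" "bij_betw C {..<k} J"
    using bij_betw_trans[OF u bijI] bij_betw_trans[OF c bijJ] by (simp_all add: U_def[abs_def] C_def[abs_def] comp_def)
  then have U: "inj_on U {..<k}" "I = U ` {..<k}" and C: "inj_on C {..<k}" "J = C ` {..<k}"
    by (auto simp: bij_betw_def)
  have V: "inj_on V {..<k}"
  proof (rule inj_onI)
    fix i j assume ij: "i \<in> {..<k}" "j \<in> {..<k}" "V i = V j"
    then have "C i = C j"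
      using centers C(2) unfolding pairwise_def center_distinct_def V_def by blast
    then show "i = j"
      using C(1) ij by (auto dest: inj_onD)
  qed
  have U_next: "U i \<noteq> U (Suc i mod k)" if "i < k" for i
    using inj_onD[OF U(1), of i "Suc i mod k"] that k by (cases "Suc i = k") auto
  have path: "path_column (C i) (U i) (a i) (V i) (b i) (U (Suc i mod k))" if "i < k" for i
    unfolding a_def b_def V_def
  proof (rule path_of_column)
    show "A $$ (U i, C i) \<noteq> 0" "A $$ (U (Suc i mod k), C i) \<noteq> 0"
      using nz[OF that] u_less[OF that] c_less[OF that] u_less[OF next_less[of i]] by (simp_all add: mat U_def C_def)
    show "C i < dim_col A" "U i < n" "U (Suc i mod k) < n"
      using pickI pickJ u_less c_less that next_less by (simp_all add: U_def C_def)
  qed (rule U_next[OF that])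
  \<comment> \<open>Rows and centers alternate; the reduction modulo \<open>k\<close> takes effect
    only at the final position \<open>2 * k\<close>, which returns to \<open>U 0\<close>.\<close>
  define vs where "vs = map (\<lambda>t. if even t then U ((t div 2) mod k) else V (t div 2)) [0..<Suc (2 * k)]"
  define as where "as = map (\<lambda>t. if even t then a (t div 2) else b (t div 2)) [0..<2 * k]"
  have vs_nth: "vs ! t = (if even t then U (t div 2) else V (t div 2))" if "t < 2 * k" for t
  proof -
    have "t div 2 mod k = t div 2"
      using that by simp
    then show ?thesis
      using that unfolding vs_def by (simp del: upt_Suc)
  qed
  have as_nth: "as ! t = (if even t then a (t div 2) else b (t div 2))" if "t < 2 * k" for t
    using that by (simp add: as_def)
  have len: "length as = 2 * k" "length vs = Suc (2 * k)"
    by (simp_all add: as_def vs_def)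
  \<comment> \<open>Square-freeness separates edges within each monomial, coprimality those of
    different monomials.\<close>
  have ab_inj: "a i = a j \<longleftrightarrow> i = j" "b i = b j \<longleftrightarrow> i = j" "a i \<noteq> b j" "b j \<noteq> a i" if "i < k" "j < k" for i j
    using inj disj[of j i] that unfolding a_def b_def U_def C_def by (auto dest: inj_onD)
  have half: "t div 2 < k" if "t < 2 * k" for t
    using that by simp
  have half_eq: "s = t" if "even s \<longleftrightarrow> even t" "s div 2 = t div 2" for s t :: nat
    using that by presburger
  have "distinct as"
    unfolding distinct_conv_nth len
    using ab_inj half half_eq by (simp add: as_nth) metis
  moreover have "hd vs = last vs"
  proof -
    have "vs \<noteq> []" using len by auto
    then have "hd vs = vs ! 0" "last vs = vs ! (2 * k)"
      using len by (simp_all add: hd_conv_nth last_conv_nth)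
    then show ?thesis
      unfolding vs_def by (simp del: upt_Suc)
  qed
  moreover have "as ! t < length fs \<and> fs ! (as ! t) = {vs ! t, vs ! (Suc t mod length as)}"
    if t: "t < length as" for t
  proof (cases "even t")
    case True
    then obtain i where i: "t = 2 * i" by (rule evenE)
    then have "i < k" "Suc t mod length as = 2 * i + 1"
      using t len by auto
    then show ?thesis
      using path[of i] i by (simp add: path_column_def as_nth vs_nth)
  next
    case False
    then obtain i where i: "t = 2 * i + 1" by (rule oddE)
    then have "i < k"
      using t len by auto
    moreover have "Suc t mod length as = 2 * (Suc i mod k)"
      unfolding len i by (simp add: mult_mod_right)
    ultimately show ?thesis
      using path[of i] i next_less[of i] by (simp add: path_column_def as_nth vs_nth)
  qed
  ultimately have E: "even_circuit fs vs as"
    unfolding even_circuit_cyclic using len k by auto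
  \<comment> \<open>Positions of equal parity lie both among the rows or both among the
    centers.\<close>
  moreover have "vs ! i \<noteq> vs ! j" if "i < j" "j < 2 * k" "even (j - i)" for i j
  proof -
    have "even i \<longleftrightarrow> even j" "i div 2 \<noteq> j div 2"
      using that half_eq[of i j] by auto
    then show ?thesis
      using that U(1) V half[of i] half[of j] by (auto simp: vs_nth dest: inj_onD)
  qed
  ultimately have ind: "indecomposable_even_circuit fs vs as"
    unfolding indecomposable_even_circuit_iff[OF E] len by blast
  have "path_column (C i) (U i) (as ! (2 * i)) (V i) (as ! (2 * i + 1)) (U (Suc i mod k))" if "i < k" for i
    using path[OF that] that by (simp add: as_nth)
  moreover have "C i < dim_col A" if "i < k" for i
    using pickJ c_less that by (simp add: C_def)
  \<comment> \<open>Computing \<open>det M\<close> afresh along the cycle settles the relative sign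
    of its two monomials.\<close>
  ultimately have "det M = circuit_binomial as \<or> det M = - circuit_binomial as"
    unfolding M_eq using det_submatrix_path_columns(1)[OF k len(1) U(1) V _ _ U(2) C(2)] by blast
  with ind show ?thesis
    by blast
qed

end

theorem theorem3p6:
  fixes n :: nat and fs :: "nat set list"
    and B :: "'k::field mpoly mpoly mat" and A :: "'k mpoly mat"
  assumes "infinite (UNIV :: 'k set)"
    and "simple_graph n fs"
    and "jacobian_dual n (taylor_matrix fs) B"
    and "A = reduced_jacobian_dual B"
  shows "(\<forall>vs as. indecomposable_even_circuit fs vs as \<longrightarrow>
            (\<exists>I J M. square_submatrix A I J M \<and>
               squarefree_coprime_binomial (det M) \<and>
               pairwise (center_distinct fs A) J \<and>
               (det M = circuit_binomial as \<or> det M = - circuit_binomial as))) \<and>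
         (\<forall>I J M. square_submatrix A I J M \<and>
            squarefree_coprime_binomial (det M) \<and>
            pairwise (center_distinct fs A) J \<longrightarrow>
            (\<exists>vs as. indecomposable_even_circuit fs vs as \<and>
               (det M = circuit_binomial as \<or> det M = - circuit_binomial as)))"
proof -
  interpret taylor_reduced_dual n fs B A
    using assms(2-4) by unfold_locales
  show ?thesis
    using minor_of_circuit circuit_of_minor by blast
qed

end
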